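(* Let $R,M$ be fixed and independent of other input parameters. Any streaming algorithm that achieves regret $R$ for the experts problem with $n$ experts and $T$ days with probability at least $1-2^{-\Theta(T)}$ must use at least $\Omega\left(\frac{nM}{RT}\right)$ space, for $n=o(2^T)$, where the best expert makes $M$ mistakes.
   Context: Experts problem (streaming, discrete predictions). There are $n$ experts and $T$ days. On each day, the algorithm receives the predictions of all $n$ experts (elements of a fixed finite set, e.g. $\{0,1\}$), outputs its own prediction, and then the correct outcome is revealed. A prediction costs $0$ if it equals the outcome and $1$ otherwise (a mistake). The number of mistakes of the best expert is the minimum over experts of the total number of mistakes made over the $T$ days; it is denoted $M$. Regret is amortized over days: the algorithm achieves regret $R$ if its total number of mistakes exceeds that of the best expert by at most $RT$. The algorithm may be randomized; the success probability is over its internal randomness, for each fixed input stream. The space is the number of bits of memory the algorithm keeps while processing the stream. Here $2^{-\Theta(T)}$ means $2^{-aT}$ for a constant $a>0$, and the constant in $\Omega(\cdot)$ may depend on $a$.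
   Formalization: Proved for 0 < R < 1-1/q and, for large T, n at least q, where q is the number of possible predictions (q=2: R<1/2, n at least 2); for larger R guessing uniformly at random, and for n=1 following the only expert, needs no memory, so the claim fails there. *)

theory Defs
  imports "HOL-Probability.Probability_Mass_Function" "HOL-Library.Landau_Symbols"
begin

text \<open>One day of the stream: the list of the experts' predictions, and the correct outcome.\<close>

type_synonym 'p day = "'p list \<times> 'p"

definition streams :: "nat \<Rightarrow> nat \<Rightarrow> 'p day list set" where
  "streams n T = {\<sigma>. length \<sigma> = T \<and> (\<forall>d\<in>set \<sigma>. length (fst d) = n)}"

definition expert_mistakes :: "'p day list \<Rightarrow> nat \<Rightarrow> nat" where
  "expert_mistakes \<sigma> i = card {t. t < length \<sigma> \<and> fst (\<sigma> ! t) ! i \<noteq> snd (\<sigma> ! t)}"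

definition best_expert_mistakes :: "nat \<Rightarrow> 'p day list \<Rightarrow> nat" where
  "best_expert_mistakes n \<sigma> = Min (expert_mistakes \<sigma> ` {..<n})"

text \<open>
  A deterministic streaming algorithm. The \<open>bool list\<close> is the memory kept from one day to the
  next, and only this is charged as space. The \<open>nat\<close> argument is the index of the day, which the
  algorithm may use free of charge. On each day \<open>predict\<close> sees the memory and the predictions of
  all experts; \<open>update\<close> also sees the outcome. The algorithm's own prediction is determined by the
  arguments of \<open>update\<close>, so it is not passed again.
\<close>

record 'p streaming_alg =
  init :: "bool list"
  predict :: "nat \<Rightarrow> bool list \<Rightarrow> 'p list \<Rightarrow> 'p"
  update :: "nat \<Rightarrow> bool list \<Rightarrow> 'p list \<Rightarrow> 'p \<Rightarrow> bool list"

definition det_space :: "nat \<Rightarrow> 'p streaming_alg \<Rightarrow> bool" where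
  "det_space s A \<longleftrightarrow> length (init A) = s \<and>
     (\<forall>t m xs y. length m = s \<longrightarrow> length (update A t m xs y) = s)"

primrec mistakes_from :: "'p streaming_alg \<Rightarrow> nat \<Rightarrow> bool list \<Rightarrow> 'p day list \<Rightarrow> nat" where
  "mistakes_from A t m [] = 0"
| "mistakes_from A t m (d # ds) =
     (if predict A t m (fst d) = snd d then 0 else 1)
     + mistakes_from A (Suc t) (update A t m (fst d) (snd d)) ds"

definition alg_mistakes :: "'p streaming_alg \<Rightarrow> 'p day list \<Rightarrow> nat" where
  "alg_mistakes A \<sigma> = mistakes_from A 0 (init A) \<sigma>"

text \<open>
  A randomized streaming algorithm is a probability distribution over deterministic ones. The
  random choices are thus not charged as space even if they are used again on later days, which
  includes algorithms that toss fresh coins every day. A discrete distribution is no restriction: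
  for given \<open>n\<close>, \<open>T\<close> and space there are only finitely many different behaviours on the streams.
\<close>

type_synonym 'p rand_alg = "'p streaming_alg pmf"

definition uses_space :: "nat \<Rightarrow> 'p rand_alg \<Rightarrow> bool" where
  "uses_space s \<A> \<longleftrightarrow> (\<forall>A\<in>set_pmf \<A>. det_space s A)"

text \<open>
  Regret \<open>R\<close> (amortized over the days) with probability at least \<open>p\<close>, on each fixed stream whose
  best expert makes exactly \<open>M\<close> mistakes. Nothing is required on other streams.
\<close>

definition achieves_regret ::
  "nat \<Rightarrow> nat \<Rightarrow> nat \<Rightarrow> real \<Rightarrow> real \<Rightarrow> 'p rand_alg \<Rightarrow> bool" where
  "achieves_regret n T M R p \<A> \<longleftrightarrow>
     (\<forall>\<sigma>\<in>streams n T. best_expert_mistakes n \<sigma> = M \<longrightarrow>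
        measure_pmf.prob \<A>
          {A. real (alg_mistakes A \<sigma>) \<le> real (best_expert_mistakes n \<sigma>) + R * real T} \<ge> p)"

end

(* Fix a deterministic algorithm with s bits of memory and let its trace on k days be the list of
   memory states and mistakes. On the streams with a given trace the days are independent, day t
   ranging over a set S_t. On uniformly random days the algorithm errs with probability 1 - 1/q per
   day (q = number of predictions), so its number of mistakes exceeds M + R T with probability at
   least some constant; and as there are only 2^((s+1)k) traces, the product of the densities of
   the S_t is essentially at least 2^(-(s+1)k). By an exponential moment bound, a set S of density
   d allows only O(log(1/d)) experts that are right on S noticeably less often than with
   probability 1/q. Hence if s k is small compared to n M, at least half of the experts have at
   most M days on which their being right is noticeably unlikely given the trace. Planting such an
   expert, who errs at most on these M days, reduces the probability of the trace by a factor
   of at most (1 - delta)^k. Since M is fixed, guessing the M days costs only a polynomial factor,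
   so some distribution on streams with a good expert makes every such algorithm fail with
   probability more than 2^(-aT). *)

theory Submission
  imports Defs "HOL-Real_Asymp.Real_Asymp"
begin

section \<open>Lists drawn from a product of sets\<close>

definition prod_lists :: "nat \<Rightarrow> (nat \<Rightarrow> 'a set) \<Rightarrow> 'a list set" where
  "prod_lists k F = {xs. length xs = k \<and> (\<forall>t<k. xs ! t \<in> F t)}"

lemma prod_lists_0 [simp]: "prod_lists 0 F = {[]}"
  by (auto simp: prod_lists_def)

lemma prod_lists_Suc:
  "prod_lists (Suc k) F = (\<lambda>(xs, x). xs @ [x]) ` (prod_lists k F \<times> F k)"
proof (intro equalityI subsetI)
  fix xs assume xs: "xs \<in> prod_lists (Suc k) F"
  then have "xs \<noteq> []" by (auto simp: prod_lists_def)
  then have "xs = butlast xs @ [last xs]" by simp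
  moreover have "butlast xs \<in> prod_lists k F" "last xs \<in> F k"
    using xs \<open>xs \<noteq> []\<close> by (auto simp: prod_lists_def nth_butlast last_conv_nth)
  ultimately show "xs \<in> (\<lambda>(xs, x). xs @ [x]) ` (prod_lists k F \<times> F k)"
    by force
qed (auto simp: prod_lists_def nth_append less_Suc_eq)

lemma finite_prod_lists: "(\<And>t. t < k \<Longrightarrow> finite (F t)) \<Longrightarrow> finite (prod_lists k F)"
  by (induction k) (auto simp: prod_lists_Suc)

text \<open>Distributivity; in probabilistic terms, the coordinates of a uniformly random element
  are independent. The semiring is kept general because cardinalities need \<open>nat\<close> and
  weighted sums need \<open>real\<close>.\<close>

lemma sum_prod_lists:
  fixes h :: "nat \<Rightarrow> 'a \<Rightarrow> 'b::comm_semiring_1"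
  shows "(\<Sum>xs\<in>prod_lists k F. \<Prod>t<k. h t (xs ! t)) = (\<Prod>t<k. \<Sum>x\<in>F t. h t x)"
proof (induction k)
  case (Suc k)
  have inj: "inj_on (\<lambda>(xs, x). xs @ [x]) (prod_lists k F \<times> F k)"
    by (auto simp: inj_on_def)
  have "(\<Sum>xs\<in>prod_lists (Suc k) F. \<Prod>t<Suc k. h t (xs ! t)) =
      (\<Sum>(xs, x)\<in>prod_lists k F \<times> F k. \<Prod>t<Suc k. h t ((xs @ [x]) ! t))"
    unfolding prod_lists_Suc by (subst sum.reindex[OF inj]) (simp add: case_prod_beta o_def)
  also have "\<dots> = (\<Sum>(xs, x)\<in>prod_lists k F \<times> F k. (\<Prod>t<k. h t (xs ! t)) * h k x)"
    by (rule sum.cong) (auto simp: prod_lists_def nth_append)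
  also have "\<dots> = (\<Sum>xs\<in>prod_lists k F. \<Prod>t<k. h t (xs ! t)) * (\<Sum>x\<in>F k. h k x)"
    by (simp add: sum_product sum.cartesian_product)
  finally show ?case using Suc by simp
qed simp

lemma card_prod_lists: "card (prod_lists k F) = (\<Prod>t<k. card (F t))"
  using sum_prod_lists[where h = "\<lambda>_ _. 1::nat" and k = k and F = F] by simp

section \<open>Counting days and streams\<close>

definition days :: "nat \<Rightarrow> 'p day set" where
  "days n = {d. length (fst d) = n}"

lemma days_eq: "days n = prod_lists n (\<lambda>_. UNIV) \<times> UNIV"
  by (auto simp: days_def prod_lists_def)

lemma finite_days [simp]: "finite (days n :: 'p::finite day set)"
  by (simp add: days_eq finite_prod_lists)

lemma card_days: "card (days n :: 'p::finite day set) = CARD('p) ^ n * CARD('p)"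
  by (simp add: days_eq card_prod_lists card_cartesian_product)

lemma card_days_pos: "0 < card (days n :: 'p::finite day set)"
  by (simp add: card_days)

lemma streams_eq: "streams n k = prod_lists k (\<lambda>_. days n)"
  unfolding streams_def prod_lists_def days_def by (auto simp: all_set_conv_all_nth)

lemma finite_streams [simp]: "finite (streams n k :: 'p::finite day list set)"
  by (simp add: streams_eq finite_prod_lists)

lemma card_streams: "card (streams n k :: 'p::finite day list set) = card (days n :: 'p day set) ^ k"
  by (simp add: streams_eq card_prod_lists)

text \<open>Given the outcome of a uniformly random day, the experts are right independently, each
  with probability \<open>1 / CARD('p)\<close>, so every expert in \<open>I\<close> contributes one
  factor. The value \<open>x = exp (- \<delta>)\<close> yields a moment generating function, and
  \<open>x = 0\<close> counts days on which all of \<open>I\<close> err.\<close>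

lemma exp_sum_agreements:
  fixes I :: "nat set" and x :: real
  assumes "I \<subseteq> {..<n}"
  shows "(\<Sum>d\<in>(days n :: 'p::finite day set). \<Prod>i\<in>I. if fst d ! i = snd d then x else 1) =
    real (card (days n :: 'p day set)) * (1 - (1 - x) / real CARD('p)) ^ card I"
proof -
  let ?q = "real CARD('p)"
  have q: "?q > 0" by simp
  have I_prod: "(\<Prod>i\<in>I. g i) = (\<Prod>i<n. if i \<in> I then g i else 1)" for g :: "nat \<Rightarrow> real"
    using assms by (subst prod.If_cases) (auto simp: Int_absorb1)
  have one: "(\<Sum>v\<in>(UNIV::'p set). if v = y then x else 1) = ?q * (1 - (1 - x) / ?q)" for y :: 'p
  proof -
    have "(\<Sum>v\<in>(UNIV::'p set). if v = y then x else 1)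
        = (\<Sum>v\<in>(UNIV::'p set). 1 - (if v = y then 1 - x else 0))"
      by (rule sum.cong) auto
    also have "\<dots> = ?q - (1 - x)" by (simp add: sum_subtractf)
    also have "\<dots> = ?q * (1 - (1 - x) / ?q)" using q by (simp add: field_simps)
    finally show ?thesis .
  qed
  have "(\<Sum>xs\<in>prod_lists n (\<lambda>_. UNIV). \<Prod>i\<in>I. if xs ! i = y then x else 1)
      = ?q ^ n * (1 - (1 - x) / ?q) ^ card I" for y :: 'p
  proof -
    have "(\<Sum>xs\<in>prod_lists n (\<lambda>_. UNIV). \<Prod>i\<in>I. if xs ! i = y then x else 1)
        = (\<Prod>i<n. \<Sum>v\<in>(UNIV::'p set). if i \<in> I then (if v = y then x else 1) else 1)"
      by (simp only: I_prod sum_prod_lists[where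
            h = "\<lambda>i v. if i \<in> I then (if v = y then x else 1) else 1"])
    also have "\<dots> = (\<Prod>i<n. ?q * (if i \<in> I then 1 - (1 - x) / ?q else 1))"
      using one by (intro prod.cong) auto
    also have "\<dots> = ?q ^ n * (1 - (1 - x) / ?q) ^ card I"
      by (simp add: prod.distrib I_prod[symmetric])
    finally show ?thesis .
  qed
  then have "(\<Sum>y\<in>(UNIV::'p set). \<Sum>xs\<in>prod_lists n (\<lambda>_. UNIV). \<Prod>i\<in>I. if xs ! i = y then x else 1)
      = ?q * (?q ^ n * (1 - (1 - x) / ?q) ^ card I)"
    by simp
  moreover have "(\<Sum>d\<in>(days n :: 'p day set). \<Prod>i\<in>I. if fst d ! i = snd d then x else 1) =
      (\<Sum>xs\<in>prod_lists n (\<lambda>_. UNIV). \<Sum>y\<in>(UNIV::'p set). \<Prod>i\<in>I. if xs ! i = y then x else 1)"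
    by (simp add: days_eq sum.cartesian_product case_prod_beta)
  moreover have "\<dots> = (\<Sum>y\<in>(UNIV::'p set). \<Sum>xs\<in>prod_lists n (\<lambda>_. UNIV). \<Prod>i\<in>I. if xs ! i = y then x else 1)"
    by (rule sum.swap)
  ultimately show ?thesis
    by (simp add: card_days)
qed

section \<open>Experts that are rarely right on a set of days\<close>

text \<open>On all of \<open>days n\<close> every expert is right with frequency
  \<open>1 / CARD('p)\<close>; \<open>\<delta>\<close> is the relative shortfall from this value.
  Multiplied out to avoid dividing by \<open>card S\<close>.\<close>

definition rarely_right :: "real \<Rightarrow> nat \<Rightarrow> 'p day set \<Rightarrow> nat set" where
  "rarely_right \<delta> n S = {i. i < n \<and>
     real CARD('p) * real (card {d\<in>S. fst d ! i = snd d}) < (1 - \<delta>) * real (card S)}"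

text \<open>Compare the moment generating functions of the number of right experts in
  \<open>rarely_right \<delta> n S\<close> on a day from \<open>S\<close> (bounded below by Jensen) and on an arbitrary
  day.\<close>

lemma card_rarely_right:
  fixes S :: "'p::finite day set"
  assumes "S \<subseteq> days n" "S \<noteq> {}" "0 < \<delta>" "\<delta> < 1"
  shows "real (card (rarely_right \<delta> n S)) \<le>
    2 * real CARD('p) / \<delta>\<^sup>2 * ln (real (card (days n :: 'p day set)) / real (card S))"
proof -
  define q where "q = real CARD('p)"
  define I where "I = rarely_right \<delta> n S"
  define m where "m = real (card I)"
  define N where "N = real (card (days n :: 'p day set))"
  define \<mu> where "\<mu> = m * (1 - \<delta>) / q"
  define f where "f d = real (card {i\<in>I. fst d ! i = snd d})" for d :: "'p day"
  have q: "q > 0" by (simp add: q_def)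
  have q1: "q \<ge> 1" unfolding q_def using zero_less_card_finite[where 'a='p] by linarith
  have fS: "finite S" using assms(1) by (rule finite_subset) simp
  have S0: "real (card S) > 0" using fS assms(2) by (simp add: card_gt_0_iff)
  have N0: "N > 0" unfolding N_def using card_days_pos[where 'p='p] by simp
  have I: "I \<subseteq> {..<n}" by (auto simp: I_def rarely_right_def)
  then have fI: "finite I" using finite_subset by blast
  have "(\<Sum>d\<in>S. f d) = (\<Sum>d\<in>S. \<Sum>i\<in>I. if fst d ! i = snd d then 1 else 0)"
    using fI by (simp add: f_def sum.If_cases Collect_conj_eq)
  also have "\<dots> = (\<Sum>i\<in>I. \<Sum>d\<in>S. if fst d ! i = snd d then 1 else 0)"
    by (rule sum.swap)
  also have "\<dots> = (\<Sum>i\<in>I. real (card {d\<in>S. fst d ! i = snd d}))"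
    using fS by (simp add: sum.If_cases Collect_conj_eq)
  also have "\<dots> \<le> (\<Sum>i\<in>I. (1 - \<delta>) * real (card S) / q)"
    using q by (intro sum_mono) (auto simp: I_def rarely_right_def q_def field_simps)
  finally have sumf: "(\<Sum>d\<in>S. f d) \<le> \<mu> * real (card S)"
    by (simp add: \<mu>_def m_def field_simps)
  \<comment> \<open>Jensen's inequality by hand: the tangent of the exponential at
    \<open>\<mu>\<close> is a lower bound, and by \<open>sumf\<close> its linear terms have a
    nonnegative sum over \<open>S\<close>.\<close>
  have "exp (- \<delta> * \<mu>) * real (card S)
      \<le> exp (- \<delta> * \<mu>) * (real (card S) + \<delta> * (\<mu> * real (card S) - (\<Sum>d\<in>S. f d)))"
    using sumf assms(3) by (intro mult_left_mono) auto
  also have "\<dots> = (\<Sum>d\<in>S. exp (- \<delta> * \<mu>) * (1 + (- \<delta> * (f d - \<mu>))))"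
    by (simp add: sum_distrib_left[symmetric] sum.distrib sum_subtractf sum_negf right_diff_distrib
        mult.commute)
  also have "\<dots> \<le> (\<Sum>d\<in>S. exp (- \<delta> * \<mu>) * exp (- \<delta> * (f d - \<mu>)))"
    by (intro sum_mono mult_left_mono exp_ge_add_one_self) auto
  also have "\<dots> = (\<Sum>d\<in>S. exp (- \<delta> * f d))"
    by (simp add: exp_add[symmetric] algebra_simps)
  also have "\<dots> \<le> (\<Sum>d\<in>days n. exp (- \<delta> * f d))"
    using assms(1) by (intro sum_mono2) auto
  also have "\<dots> = (\<Sum>d\<in>(days n :: 'p day set). \<Prod>i\<in>I. if fst d ! i = snd d then exp (- \<delta>) else 1)"
  proof (rule sum.cong)
    fix d :: "'p day"
    show "exp (- \<delta> * f d) = (\<Prod>i\<in>I. if fst d ! i = snd d then exp (- \<delta>) else 1)"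
      using fI by (simp add: prod.If_cases f_def exp_of_nat_mult[symmetric] Collect_conj_eq mult.commute)
  qed simp
  also have "\<dots> = N * (1 - (1 - exp (- \<delta>)) / q) ^ card I"
    using exp_sum_agreements[OF I] by (simp add: N_def q_def)
  also have "\<dots> \<le> N * exp (- (1 - exp (- \<delta>)) / q) ^ card I"
  proof -
    have "(1 - exp (- \<delta>)) / q \<le> 1" using q1 q by (simp add: divide_le_eq) (smt (verit) exp_gt_zero)
    then have "0 \<le> 1 - (1 - exp (- \<delta>)) / q" by simp
    moreover have "1 - z / q \<le> exp (- z / q)" for z
      using exp_ge_add_one_self[of "- z / q"] by simp
    ultimately have "(1 - (1 - exp (- \<delta>)) / q) ^ card I \<le> exp (- (1 - exp (- \<delta>)) / q) ^ card I"
      by (rule power_mono[rotated])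
    then show ?thesis using N0 by (intro mult_left_mono) auto
  qed
  also have "\<dots> = N * exp (- m * (1 - exp (- \<delta>)) / q)"
    by (simp add: exp_of_nat_mult[symmetric] m_def right_diff_distrib diff_divide_distrib)
  also have "\<dots> \<le> N * exp (- m * (\<delta> - \<delta>\<^sup>2 / 2) / q)"
  proof -
    have "exp (- \<delta>) \<le> 1 - \<delta> + \<delta>\<^sup>2 / 2"
    proof -
      \<comment> \<open>The quadratic Taylor polynomials of \<open>exp (- \<delta>)\<close> and
        \<open>exp \<delta>\<close> have product \<open>1 + \<delta> ^ 4 / 4\<close>, so the lower
        Taylor bound for \<open>exp \<delta>\<close> becomes an upper bound for
        \<open>exp (- \<delta>)\<close>.\<close>
      have "1 \<le> 1 + \<delta> ^ 4 / 4" by simp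
      also have "\<dots> = (1 - \<delta> + \<delta>\<^sup>2 / 2) * (1 + \<delta> + \<delta>\<^sup>2 / 2)"
        by (simp add: field_simps power2_eq_square power4_eq_xxxx)
      also have "\<dots> \<le> (1 - \<delta> + \<delta>\<^sup>2 / 2) * exp \<delta>"
        using assms exp_lower_Taylor_quadratic[of \<delta>] by (intro mult_left_mono) auto
      finally show ?thesis by (simp add: exp_minus field_simps)
    qed
    then have "m * (\<delta> - \<delta>\<^sup>2 / 2) \<le> m * (1 - exp (- \<delta>))"
      by (intro mult_left_mono) (auto simp: m_def)
    then show ?thesis using N0 q by (auto intro!: divide_right_mono)
  qed
  finally have "exp (- \<delta> * \<mu>) * real (card S) \<le> N * exp (- m * (\<delta> - \<delta>\<^sup>2 / 2) / q)" .
  then have "exp (\<delta> * \<mu>) * (exp (- \<delta> * \<mu>) * real (card S))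
      \<le> exp (\<delta> * \<mu>) * (N * exp (- m * (\<delta> - \<delta>\<^sup>2 / 2) / q))"
    by (intro mult_left_mono) auto
  moreover have "exp (\<delta> * \<mu>) * (exp (- \<delta> * \<mu>) * real (card S)) = real (card S)"
    by (simp add: exp_minus field_simps)
  moreover have "exp (\<delta> * \<mu>) * (N * exp (- m * (\<delta> - \<delta>\<^sup>2 / 2) / q)) = N * exp (- (m * \<delta>\<^sup>2 / (2 * q)))"
  proof -
    \<comment> \<open>The terms linear in \<open>\<delta>\<close> cancel; half of the quadratic one
      survives.\<close>
    have "\<delta> * \<mu> + (- m * (\<delta> - \<delta>\<^sup>2 / 2) / q) = - (m * \<delta>\<^sup>2 / (2 * q))"
      using q by (simp add: \<mu>_def field_simps power2_eq_square)
    then have "exp (\<delta> * \<mu>) * exp (- m * (\<delta> - \<delta>\<^sup>2 / 2) / q) = exp (- (m * \<delta>\<^sup>2 / (2 * q)))"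
      by (simp add: exp_add[symmetric])
    then show ?thesis by (metis mult.left_commute)
  qed
  ultimately have "real (card S) \<le> N * exp (- (m * \<delta>\<^sup>2 / (2 * q)))" by (simp only:)
  then have "exp (m * \<delta>\<^sup>2 / (2 * q)) \<le> N / real (card S)"
    using S0 by (simp add: exp_minus field_simps)
  then have "m * \<delta>\<^sup>2 / (2 * q) \<le> ln (N / real (card S))"
    using N0 S0 by (subst ln_ge_iff) auto
  then show ?thesis
    using q assms(3) by (simp add: m_def I_def N_def q_def field_simps)
qed

text \<open>Double counting of the pairs of a day \<open>t\<close> and an expert rarely right on
  \<open>S t\<close>: by \<open>card_rarely_right\<close> and \<open>deficit\<close> there are at
  most \<open>n * M / 2\<close> of them, so at least half of the experts have at most
  \<open>M\<close> such days. For each of these experts a single \<open>B\<close> covering its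
  exceptional days already gives the bound, since off \<open>B\<close> a day keeps at least a
  fraction \<open>(1 - \<delta>) / CARD('p)\<close> of \<open>S t\<close>.\<close>

lemma planted_class_bound:
  fixes S :: "nat \<Rightarrow> 'p::finite day set"
  assumes S: "\<And>t. t < k \<Longrightarrow> S t \<subseteq> days n" "\<And>t. t < k \<Longrightarrow> S t \<noteq> {}"
    and \<delta>: "0 < \<delta>" "\<delta> < 1" and M: "1 \<le> M" "M \<le> k"
    and deficit: "2 * real CARD('p) / \<delta>\<^sup>2 *
        ln (real (card (days n :: 'p day set)) ^ k / (\<Prod>t<k. real (card (S t)))) \<le> real n * real M / 2"
  shows "real n / 2 * ((1 - \<delta>) / real CARD('p)) ^ (k - M) * (\<Prod>t<k. real (card (S t))) \<le>
    (\<Sum>i<n. \<Sum>B | B \<subseteq> {..<k} \<and> card B = M.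
       \<Prod>t<k. real (card {d\<in>S t. t \<in> B \<or> fst d ! i = snd d}))"
proof -
  define q where "q = real CARD('p)"
  define P where "P = (\<Prod>t<k. real (card (S t)))"
  define w where "w = ((1 - \<delta>) / q) ^ (k - M) * P"
  define D where "D i = {t. t < k \<and> i \<in> rarely_right \<delta> n (S t)}" for i
  define bad where "bad = {i. i < n \<and> M < card (D i)}"
  have q: "q > 0" by (simp add: q_def)
  have N0: "real (card (days n :: 'p day set)) > 0" using card_days_pos[where 'p='p] by simp
  have fS: "finite (S t)" if "t < k" for t using S(1)[OF that] by (rule finite_subset) simp
  have S0: "real (card (S t)) > 0" if "t < k" for t
    using fS[OF that] S(2)[OF that] by (simp add: card_gt_0_iff)
  have w0: "w \<ge> 0" using \<delta> q by (simp add: w_def P_def prod_nonneg)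
  have "(\<Sum>i<n. real (card (D i))) = (\<Sum>i<n. \<Sum>t<k. if i \<in> rarely_right \<delta> n (S t) then 1 else 0)"
    by (intro sum.cong) (auto simp: D_def sum.If_cases Collect_conj_eq lessThan_def)
  also have "\<dots> = (\<Sum>t<k. \<Sum>i<n. if i \<in> rarely_right \<delta> n (S t) then 1 else 0)"
    by (rule sum.swap)
  also have "\<dots> = (\<Sum>t<k. real (card (rarely_right \<delta> n (S t))))"
    by (intro sum.cong) (auto simp: sum.If_cases rarely_right_def Collect_conj_eq lessThan_def)
  also have "\<dots> \<le> (\<Sum>t<k. 2 * q / \<delta>\<^sup>2 * ln (real (card (days n :: 'p day set)) / real (card (S t))))"
    unfolding q_def using S \<delta> by (intro sum_mono card_rarely_right) auto
  also have "\<dots> = 2 * q / \<delta>\<^sup>2 * ln (\<Prod>t<k. real (card (days n :: 'p day set)) / real (card (S t)))"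
    using S0 N0 by (subst ln_prod) (auto simp: sum_distrib_left)
  also have "\<dots> \<le> real n * real M / 2"
    using deficit by (simp add: prod_dividef q_def)
  finally have sumD: "(\<Sum>i<n. real (card (D i))) \<le> real n * real M / 2" .
  \<comment> \<open>Markov's inequality for the number of exceptional days of an expert.\<close>
  have "real (card bad) * real M = (\<Sum>i\<in>bad. real M)" by simp
  also have "\<dots> \<le> (\<Sum>i\<in>bad. real (card (D i)))" by (intro sum_mono) (auto simp: bad_def)
  also have "\<dots> \<le> (\<Sum>i<n. real (card (D i)))" by (intro sum_mono2) (auto simp: bad_def)
  finally have "real (card bad) * real M \<le> real n / 2 * real M" using sumD by simp
  then have cbad: "real (card bad) \<le> real n / 2" using M(1) by (simp add: mult_le_cancel_right)
  have bound: "w \<le> (\<Sum>B | B \<subseteq> {..<k} \<and> card B = M.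
       \<Prod>t<k. real (card {d\<in>S t. t \<in> B \<or> fst d ! i = snd d}))" if i: "i \<in> {..<n} - bad" for i
  proof -
    have "D i \<subseteq> {..<k}" "card (D i) \<le> M" using i by (auto simp: D_def bad_def)
    \<comment> \<open>The sum ranges over sets of size exactly \<open>M\<close>, so
      \<open>D i\<close> is padded; \<open>M \<le> k\<close> leaves room for this.\<close>
    then obtain B where B: "D i \<subseteq> B" "B \<subseteq> {..<k}" "card B = M"
      using exists_subset_between[of "D i" M "{..<k}"] M(2) by auto
    have "w = (\<Prod>t<k. (if t \<in> B then 1 else (1 - \<delta>) / q) * real (card (S t)))"
    proof -
      have "{..<k} \<inter> - B = {..<k} - B" by auto
      moreover have "card ({..<k} - B) = k - M" using B by (simp add: card_Diff_subset finite_subset)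
      ultimately show ?thesis
        by (simp add: w_def P_def prod.distrib prod.If_cases)
    qed
    also have "\<dots> \<le> (\<Prod>t<k. real (card {d\<in>S t. t \<in> B \<or> fst d ! i = snd d}))"
    proof (intro prod_mono conjI)
      fix t assume t: "t \<in> {..<k}"
      show "0 \<le> (if t \<in> B then 1 else (1 - \<delta>) / q) * real (card (S t))" using \<delta> q by simp
      show "(if t \<in> B then 1 else (1 - \<delta>) / q) * real (card (S t))
          \<le> real (card {d\<in>S t. t \<in> B \<or> fst d ! i = snd d})"
      proof (cases "t \<in> B")
        case False
        then have "i \<notin> rarely_right \<delta> n (S t)" using B(1) t by (auto simp: D_def)
        then show ?thesis using i False q by (simp add: rarely_right_def q_def field_simps not_less)
      qed simp
    qed
    also have "\<dots> \<le> (\<Sum>B | B \<subseteq> {..<k} \<and> card B = M.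
       \<Prod>t<k. real (card {d\<in>S t. t \<in> B \<or> fst d ! i = snd d}))"
      using B by (intro member_le_sum) (auto intro: prod_nonneg)
    finally show ?thesis .
  qed
  have "real n / 2 * w \<le> real (card ({..<n} - bad)) * w"
  proof (rule mult_right_mono[OF _ w0])
    have "bad \<subseteq> {..<n}" by (auto simp: bad_def)
    then have "card ({..<n} - bad) = n - card bad" "card bad \<le> n"
      using card_mono[of "{..<n}" bad] by (auto simp: card_Diff_subset finite_subset)
    then show "real n / 2 \<le> real (card ({..<n} - bad))" using cbad by simp
  qed
  also have "\<dots> = (\<Sum>i\<in>{..<n} - bad. w)" by simp
  also have "\<dots> \<le> (\<Sum>i\<in>{..<n} - bad. \<Sum>B | B \<subseteq> {..<k} \<and> card B = M.
       \<Prod>t<k. real (card {d\<in>S t. t \<in> B \<or> fst d ! i = snd d}))"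
    using bound by (rule sum_mono)
  also have "\<dots> \<le> (\<Sum>i<n. \<Sum>B | B \<subseteq> {..<k} \<and> card B = M.
       \<Prod>t<k. real (card {d\<in>S t. t \<in> B \<or> fst d ! i = snd d}))"
    by (intro sum_mono2) (auto intro!: sum_nonneg prod_nonneg)
  finally show ?thesis by (simp add: w_def P_def q_def mult.assoc)
qed


section \<open>Traces of a deterministic algorithm\<close>

text \<open>One bit for being wrong replaces the prediction itself: it suffices to recover the
  number of mistakes, and it keeps the number of traces on \<open>k\<close> days at
  \<open>2 ^ ((s + 1) * k)\<close>, whatever the number of possible predictions.\<close>

definition step :: "'p streaming_alg \<Rightarrow> nat \<Rightarrow> bool list \<Rightarrow> 'p day \<Rightarrow> bool list \<times> bool" where
  "step A t m d = (update A t m (fst d) (snd d), predict A t m (fst d) \<noteq> snd d)"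

primrec trace :: "'p streaming_alg \<Rightarrow> nat \<Rightarrow> bool list \<Rightarrow> 'p day list \<Rightarrow> (bool list \<times> bool) list" where
  "trace A t m [] = []"
| "trace A t m (d # ds) = step A t m d # trace A (Suc t) (fst (step A t m d)) ds"

lemma length_trace [simp]: "length (trace A t m ds) = length ds"
  by (induction ds arbitrary: t m) auto

lemma mistakes_from_trace: "mistakes_from A t m ds = length (filter snd (trace A t m ds))"
  by (induction ds arbitrary: t m) (auto simp: step_def)

lemma mistakes_from_append_ge: "mistakes_from A t m ds \<le> mistakes_from A t m (ds @ es)"
  by (induction ds arbitrary: t m) auto

lemma trace_space:
  "det_space s A \<Longrightarrow> length m = s \<Longrightarrow> set (trace A t m ds) \<subseteq> {m. length m = s} \<times> UNIV"
  by (induction ds arbitrary: t m) (auto simp: det_space_def step_def)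

text \<open>Fixing \<open>\<pi>\<close> fixes the memory before every day: \<open>m\<close> before
  the first one and the memory in entry \<open>j - 1\<close> of \<open>\<pi>\<close> before day
  \<open>j > 0\<close>. Hence the condition splits into conditions on single days.\<close>

lemma trace_eq_iff:
  "length ds = length \<pi> \<Longrightarrow>
    trace A t m ds = \<pi> \<longleftrightarrow> (\<forall>j<length \<pi>. step A (t + j) ((m # map fst \<pi>) ! j) (ds ! j) = \<pi> ! j)"
proof (induction ds arbitrary: t m \<pi>)
  case (Cons d ds)
  then obtain x \<pi>' where \<pi>: "\<pi> = x # \<pi>'" "length ds = length \<pi>'" by (cases \<pi>) auto
  show ?case
    using Cons.IH[OF \<pi>(2), of "Suc t" "fst x"] by (auto simp: \<pi>(1) All_less_Suc2)
qed auto

definition trace_days :: "nat \<Rightarrow> 'p streaming_alg \<Rightarrow> (bool list \<times> bool) list \<Rightarrow> nat \<Rightarrow> 'p day set" where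
  "trace_days n A \<pi> j = {d \<in> days n. step A j ((init A # map fst \<pi>) ! j) d = \<pi> ! j}"

text \<open>The rectangle property: within a product of sets, the streams with a given trace again
  form a product. The sets \<open>trace_days n A \<pi> t\<close> are the \<open>S_t\<close> of the
  proof idea.\<close>

lemma trace_class:
  assumes "length \<pi> = k"
  shows "{\<tau> \<in> prod_lists k F. (\<forall>t<k. \<tau> ! t \<in> days n) \<and> trace A 0 (init A) \<tau> = \<pi>}
    = prod_lists k (\<lambda>t. F t \<inter> trace_days n A \<pi> t)"
proof (rule set_eqI)
  fix \<tau>
  show "\<tau> \<in> {\<tau> \<in> prod_lists k F. (\<forall>t<k. \<tau> ! t \<in> days n) \<and> trace A 0 (init A) \<tau> = \<pi>} \<longleftrightarrow>
    \<tau> \<in> prod_lists k (\<lambda>t. F t \<inter> trace_days n A \<pi> t)"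
  proof (cases "length \<tau> = k")
    case True
    then have "trace A 0 (init A) \<tau> = \<pi> \<longleftrightarrow>
        (\<forall>j<k. step A j ((init A # map fst \<pi>) ! j) (\<tau> ! j) = \<pi> ! j)"
      using trace_eq_iff[of \<tau> \<pi> A 0 "init A"] assms by simp
    then show ?thesis
      using True unfolding prod_lists_def trace_days_def by blast
  qed (simp add: prod_lists_def)
qed

section \<open>Mistakes on uniformly random streams\<close>

text \<open>The outcome of a random day is independent of the memory and of the experts'
  predictions, so any prediction is wrong with probability \<open>1 - 1 / CARD('p)\<close>. The
  induction needs arbitrary \<open>t\<close> and \<open>m\<close> because the first day changes
  both.\<close>

lemma sum_mistakes_streams:
  fixes A :: "'p::finite streaming_alg"
  shows "(\<Sum>\<tau>\<in>streams n k. real (mistakes_from A t m \<tau>)) =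
    real k * (1 - 1 / real CARD('p)) * real (card (streams n k :: 'p day list set))"
proof (induction k arbitrary: t m)
  case 0
  then show ?case by (simp add: streams_eq)
next
  case (Suc k)
  let ?q = "real CARD('p)"
  let ?D = "days n :: 'p day set" and ?S = "streams n k :: 'p day list set"
  have q: "?q > 0" by simp
  \<comment> \<open>Days are split off at the front, following the recursion of
    \<open>mistakes_from\<close>, whereas \<open>prod_lists_Suc\<close> splits them off at the
    end.\<close>
  have eq: "streams n (Suc k) = (\<lambda>(d, ds). d # ds) ` (?D \<times> ?S)"
  proof (intro equalityI subsetI)
    fix \<tau> :: "'p day list" assume "\<tau> \<in> streams n (Suc k)"
    then show "\<tau> \<in> (\<lambda>(d, ds). d # ds) ` (?D \<times> ?S)"
      by (cases \<tau>) (auto simp: streams_def days_def image_iff)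
  qed (auto simp: streams_def days_def)
  have inj: "inj_on (\<lambda>(d, ds). d # ds) (?D \<times> ?S)" by (auto simp: inj_on_def)
  have wrong: "(\<Sum>d\<in>?D. if predict A t m (fst d) = snd d then 0 else 1) = (1 - 1 / ?q) * real (card ?D)"
  proof -
    have "(\<Sum>d\<in>?D. if predict A t m (fst d) = snd d then 0 else 1 :: real) =
        (\<Sum>xs\<in>prod_lists n (\<lambda>_. UNIV). \<Sum>y\<in>(UNIV::'p set). 1 - (if predict A t m xs = y then 1 else 0))"
      unfolding days_eq sum.cartesian_product by (rule sum.cong) auto
    also have "\<dots> = ?q ^ n * (?q - 1)"
      by (simp add: sum_subtractf card_prod_lists)
    also have "\<dots> = (1 - 1 / ?q) * real (card ?D)"
      using q by (simp add: card_days field_simps)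
    finally show ?thesis .
  qed
  have "(\<Sum>\<tau>\<in>streams n (Suc k). real (mistakes_from A t m \<tau>)) =
      (\<Sum>d\<in>?D. \<Sum>ds\<in>?S. real (mistakes_from A t m (d # ds)))"
    unfolding eq by (subst sum.reindex[OF inj]) (simp add: sum.cartesian_product case_prod_beta o_def)
  also have "\<dots> = (\<Sum>d\<in>?D. real (card ?S) * (if predict A t m (fst d) = snd d then 0 else 1)
      + (\<Sum>ds\<in>?S. real (mistakes_from A (Suc t) (update A t m (fst d) (snd d)) ds)))"
    by (intro sum.cong) (auto simp: sum.distrib)
  also have "\<dots> = real (card ?S) * ((1 - 1 / ?q) * real (card ?D))
      + real (card ?D) * (real k * (1 - 1 / ?q) * real (card ?S))"
    by (simp only: Suc sum.distrib sum_distrib_left[symmetric] wrong sum_constant)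
      (simp add: mult_ac)
  also have "\<dots> = real (Suc k) * (1 - 1 / ?q) * (real (card ?D) * real (card ?S))"
    by (simp add: algebra_simps add_divide_distrib)
  also have "real (card ?D) * real (card ?S) = real (card (streams n (Suc k) :: 'p day list set))"
    by (simp add: card_streams)
  finally show ?case .
qed

text \<open>Reverse Markov inequality: the mean exceeds \<open>L\<close> by at least
  \<open>\<eta> * k\<close>, and no stream has more than \<open>k\<close> mistakes.\<close>

lemma card_many_mistakes:
  fixes A :: "'p::finite streaming_alg"
  assumes "L \<le> (1 - 1 / real CARD('p) - \<eta>) * real k" "k > 0" "L \<ge> 0"
  shows "\<eta> * real (card (streams n k :: 'p day list set)) \<le>
    real (card {\<tau> \<in> streams n k. L < real (alg_mistakes A \<tau>)})"
proof -
  let ?S = "streams n k :: 'p day list set"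
  let ?F = "{\<tau> \<in> ?S. L < real (alg_mistakes A \<tau>)}"
  have le: "real (alg_mistakes A \<tau>) \<le> L + (if L < real (alg_mistakes A \<tau>) then real k else 0)"
    if "\<tau> \<in> ?S" for \<tau>
  proof -
    have "alg_mistakes A \<tau> \<le> length \<tau>"
      unfolding alg_mistakes_def mistakes_from_trace using length_filter_le[of snd "trace A 0 (init A) \<tau>"]
      by simp
    then show ?thesis using that assms(3) by (auto simp: streams_def)
  qed
  have "real k * (1 - 1 / real CARD('p)) * real (card ?S) = (\<Sum>\<tau>\<in>?S. real (alg_mistakes A \<tau>))"
    unfolding alg_mistakes_def by (rule sum_mistakes_streams[symmetric])
  also have "\<dots> \<le> (\<Sum>\<tau>\<in>?S. L + (if L < real (alg_mistakes A \<tau>) then real k else 0))"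
    by (rule sum_mono) (rule le)
  also have "\<dots> = L * real (card ?S) + real k * real (card ?F)"
    by (simp add: sum.distrib sum.If_cases Collect_conj_eq mult.commute)
  also have "\<dots> \<le> (1 - 1 / real CARD('p) - \<eta>) * real k * real (card ?S) + real k * real (card ?F)"
    using assms(1) by (intro add_right_mono mult_right_mono) auto
  finally have "real k * (\<eta> * real (card ?S)) \<le> real k * real (card ?F)"
    by (simp add: algebra_simps)
  then show ?thesis using assms(2) by simp
qed

section \<open>Streams with a planted expert\<close>

text \<open>On the days in \<open>B\<close> the expert is unconstrained rather than forced to err.
  This makes the set a product of sets of days, with some streams shared by several choices of
  \<open>i\<close> and \<open>B\<close>.\<close>

definition planted :: "nat \<Rightarrow> nat \<Rightarrow> nat \<Rightarrow> nat set \<Rightarrow> 'p day list set" where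
  "planted n k i B = {\<tau> \<in> streams n k. \<forall>t<k. t \<in> B \<or> fst (\<tau> ! t) ! i = snd (\<tau> ! t)}"

lemma planted_eq: "planted n k i B = prod_lists k (\<lambda>t. {d \<in> days n. t \<in> B \<or> fst d ! i = snd d})"
  by (auto simp: planted_def streams_eq prod_lists_def)

lemma card_planted:
  assumes "i < n" "B \<subseteq> {..<k}" "card B = M"
  shows "real (card (planted n k i B :: 'p::finite day list set)) =
    real (card (days n :: 'p day set)) ^ k * (1 / real CARD('p)) ^ (k - M)"
proof -
  let ?N = "real (card (days n :: 'p day set))"
  \<comment> \<open>With \<open>x = 0\<close> the agreement sum counts the days on which expert
    \<open>i\<close> errs; the count of the right days follows by complement.\<close>
  have "(\<Sum>d\<in>(days n :: 'p day set). \<Prod>j\<in>{i}. if fst d ! j = snd d then 0 else 1) =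
      ?N * (1 - (1 - 0) / real CARD('p)) ^ card {i}"
    by (rule exp_sum_agreements) (use assms in auto)
  moreover have "(\<Sum>d\<in>(days n :: 'p day set). if fst d ! i = snd d then 0 else 1) =
      (\<Sum>d\<in>(days n :: 'p day set). 1 - (if fst d ! i = snd d then 1 else 0 :: real))"
    by (rule sum.cong) auto
  ultimately have "(\<Sum>d\<in>(days n :: 'p day set). if fst d ! i = snd d then 1 else 0) = ?N * (1 / real CARD('p))"
    by (simp add: sum_subtractf algebra_simps)
  then have right: "real (card {d \<in> (days n :: 'p day set). fst d ! i = snd d}) = ?N * (1 / real CARD('p))"
    by (simp add: sum.If_cases Collect_conj_eq)
  have "real (card (planted n k i B :: 'p day list set)) =
      (\<Prod>t<k. ?N * (if t \<in> B then 1 else 1 / real CARD('p)))"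
    unfolding planted_eq card_prod_lists of_nat_prod
    by (intro prod.cong) (auto simp: right[simplified])
  also have "\<dots> = ?N ^ k * (1 / real CARD('p)) ^ (k - M)"
  proof -
    have "{..<k} \<inter> - B = {..<k} - B" by auto
    moreover have "card ({..<k} - B) = k - M" using assms by (simp add: card_Diff_subset finite_subset)
    ultimately show ?thesis by (simp add: prod.distrib prod.If_cases)
  qed
  finally show ?thesis .
qed

text \<open>The number of mistakes is a function of the trace, so the streams with many mistakes are
  a disjoint union of trace classes.\<close>

lemma card_many_mistakes_trace:
  assumes "det_space s A" "X \<subseteq> streams n k" "finite X"
  shows "card {\<tau> \<in> X. L < real (alg_mistakes A \<tau>)} =
    (\<Sum>\<pi> | set \<pi> \<subseteq> {m. length m = s} \<times> UNIV \<and> length \<pi> = k \<and> L < real (length (filter snd \<pi>)).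
      card {\<tau> \<in> X. trace A 0 (init A) \<tau> = \<pi>})"
proof -
  let ?X = "{\<tau> \<in> X. L < real (alg_mistakes A \<tau>)}"
  let ?E = "{\<pi>. set \<pi> \<subseteq> {m::bool list. length m = s} \<times> (UNIV::bool set) \<and> length \<pi> = k
    \<and> L < real (length (filter snd \<pi>))}"
  have "finite {m::bool list. length m = s}"
    using finite_lists_length_eq[of "UNIV::bool set" s] by simp
  then have "finite {\<pi>. set \<pi> \<subseteq> {m::bool list. length m = s} \<times> (UNIV::bool set) \<and> length \<pi> = k}"
    by (intro finite_lists_length_eq) auto
  then have fE: "finite ?E" by (rule rev_finite_subset) auto
  have sub: "trace A 0 (init A) ` ?X \<subseteq> ?E"
  proof (intro image_subsetI CollectI conjI)
    fix \<tau> assume \<tau>: "\<tau> \<in> ?X"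
    show "set (trace A 0 (init A) \<tau>) \<subseteq> {m. length m = s} \<times> UNIV"
      using assms(1) by (intro trace_space) (auto simp: det_space_def)
    show "length (trace A 0 (init A) \<tau>) = k" using \<tau> assms(2) by (auto simp: streams_def)
    show "L < real (length (filter snd (trace A 0 (init A) \<tau>)))"
      using \<tau> by (simp add: alg_mistakes_def mistakes_from_trace)
  qed
  have "card ?X = (\<Sum>\<tau>\<in>?X. 1)" by simp
  also have "\<dots> = (\<Sum>\<pi>\<in>?E. \<Sum>\<tau> | \<tau> \<in> ?X \<and> trace A 0 (init A) \<tau> = \<pi>. 1)"
    using assms(3) by (intro sum.group[symmetric] fE sub) auto
  also have "\<dots> = (\<Sum>\<pi>\<in>?E. card {\<tau> \<in> X. trace A 0 (init A) \<tau> = \<pi>})"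
  proof (rule sum.cong[OF refl])
    fix \<pi> assume \<pi>: "\<pi> \<in> ?E"
    have "{\<tau>. \<tau> \<in> ?X \<and> trace A 0 (init A) \<tau> = \<pi>} = {\<tau> \<in> X. trace A 0 (init A) \<tau> = \<pi>}"
      using \<pi> by (auto simp: alg_mistakes_def mistakes_from_trace)
    then show "(\<Sum>\<tau> | \<tau> \<in> ?X \<and> trace A 0 (init A) \<tau> = \<pi>. 1) = card {\<tau> \<in> X. trace A 0 (init A) \<tau> = \<pi>}"
      by simp
  qed
  finally show ?thesis .
qed

text \<open>By \<open>card_many_mistakes\<close>, traces with many mistakes cover a fraction
  \<open>\<eta>\<close> of all streams. Those of tiny weight cover at most half of that, as there
  are few traces. For each remaining trace the logarithm in \<open>planted_class_bound\<close> is at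
  most \<open>ln (2 / \<eta>) + (s + 1) * k * ln 2\<close>, which \<open>space\<close>
  controls.\<close>

lemma planted_many_mistakes:
  fixes A :: "'p::finite streaming_alg"
  assumes A: "det_space s A" and \<delta>: "0 < \<delta>" "\<delta> < 1" and M: "1 \<le> M" "M \<le> k" and \<eta>: "0 < \<eta>"
    and L: "0 \<le> L" "L \<le> (1 - 1 / real CARD('p) - \<eta>) * real k"
    and space: "2 * real CARD('p) / \<delta>\<^sup>2 * (ln (2 / \<eta>) + (real s + 1) * real k * ln 2) \<le> real n * real M / 2"
  shows "real n / 2 * (\<eta> / 2) * (1 - \<delta>) ^ k *
      (real (card (days n :: 'p day set)) ^ k * (1 / real CARD('p)) ^ (k - M)) \<le>
    (\<Sum>i<n. \<Sum>B | B \<subseteq> {..<k} \<and> card B = M.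
       real (card {\<tau> \<in> planted n k i B. L < real (alg_mistakes A \<tau>)}))"
proof -
  define q where "q = real CARD('p)"
  define N where "N = real (card (days n :: 'p day set))"
  define paths where "paths = {\<pi>. set \<pi> \<subseteq> {m::bool list. length m = s} \<times> (UNIV::bool set) \<and> length \<pi> = k}"
  define E where "E = {\<pi>. set \<pi> \<subseteq> {m::bool list. length m = s} \<times> (UNIV::bool set) \<and> length \<pi> = k
    \<and> L < real (length (filter snd \<pi>))}"
  define W where "W \<pi> = (\<Prod>t<k. real (card (trace_days n A \<pi> t)))" for \<pi>
  define C where "C = (2::real) ^ ((s + 1) * k)"
  \<comment> \<open>The heavy traces: weight at least \<open>\<eta> / 2\<close> times the average of
    \<open>N ^ k\<close> over all \<open>C\<close> conceivable traces.\<close>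
  define H where "H = {\<pi> \<in> E. \<eta> / 2 * N ^ k \<le> C * W \<pi>}"
  define G where "G \<pi> i B = (\<Prod>t<k. real (card {d \<in> trace_days n A \<pi> t. t \<in> B \<or> fst d ! i = snd d}))"
    for \<pi> i B
  have q: "q > 0" by (simp add: q_def)
  have N0: "N > 0" unfolding N_def using card_days_pos[where 'p='p] by simp
  have C0: "C > 0" by (simp add: C_def)
  have fin_m: "finite {m::bool list. length m = s}" "card {m::bool list. length m = s} = 2 ^ s"
    using finite_lists_length_eq[of "UNIV::bool set" s] card_lists_length_eq[of "UNIV::bool set" s]
    by simp_all
  have fpaths: "finite paths"
    unfolding paths_def using fin_m by (intro finite_lists_length_eq) auto
  have cpaths: "real (card paths) = C"
    unfolding paths_def using fin_m
    by (subst card_lists_length_eq) (auto simp: C_def card_cartesian_product power_mult power_add)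
  have EP: "E \<subseteq> paths" by (auto simp: E_def paths_def)
  have fE: "finite E" using EP fpaths by (rule finite_subset)
  have HE: "H \<subseteq> E" by (auto simp: H_def)
  have W0: "W \<pi> \<ge> 0" for \<pi> by (simp add: W_def prod_nonneg)
  \<comment> \<open>Used twice: with \<open>F\<close> constantly \<open>days n\<close> for uniform
    streams, and with the factors of \<open>planted_eq\<close> for planted ones.\<close>
  have cardE: "real (card {\<tau> \<in> prod_lists k F. L < real (alg_mistakes A \<tau>)})
      = (\<Sum>\<pi>\<in>E. \<Prod>t<k. real (card (F t \<inter> trace_days n A \<pi> t)))"
    if F: "\<And>t. F t \<subseteq> days n" for F
  proof -
    have sub: "prod_lists k F \<subseteq> streams n k"
      using F by (auto simp: streams_eq prod_lists_def)
    then have "finite (prod_lists k F)" by (rule finite_subset) simp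
    then have "card {\<tau> \<in> prod_lists k F. L < real (alg_mistakes A \<tau>)} =
        (\<Sum>\<pi>\<in>E. card {\<tau> \<in> prod_lists k F. trace A 0 (init A) \<tau> = \<pi>})"
      unfolding E_def by (rule card_many_mistakes_trace[OF A sub])
    also have "\<dots> = (\<Sum>\<pi>\<in>E. \<Prod>t<k. card (F t \<inter> trace_days n A \<pi> t))"
    proof (rule sum.cong[OF refl])
      fix \<pi> assume "\<pi> \<in> E"
      then have len: "length \<pi> = k" by (simp add: E_def)
      have "{\<tau> \<in> prod_lists k F. trace A 0 (init A) \<tau> = \<pi>} =
          {\<tau> \<in> prod_lists k F. (\<forall>t<k. \<tau> ! t \<in> days n) \<and> trace A 0 (init A) \<tau> = \<pi>}"
        using F by (auto simp: prod_lists_def)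
      then show "card {\<tau> \<in> prod_lists k F. trace A 0 (init A) \<tau> = \<pi>}
          = (\<Prod>t<k. card (F t \<inter> trace_days n A \<pi> t))"
        by (simp add: trace_class[OF len] card_prod_lists)
    qed
    finally show ?thesis by simp
  qed
  have days_sub: "trace_days n A \<pi> t \<subseteq> days n" for \<pi> t by (auto simp: trace_days_def)
  have cardG: "real (card {\<tau> \<in> planted n k i B. L < real (alg_mistakes A \<tau>)}) = (\<Sum>\<pi>\<in>E. G \<pi> i B)"
    for i B
  proof -
    have "{d \<in> days n. t \<in> B \<or> fst d ! i = snd d} \<inter> trace_days n A \<pi> t =
        {d \<in> trace_days n A \<pi> t. t \<in> B \<or> fst d ! i = snd d}" for \<pi> t
      using days_sub by auto
    then show ?thesis unfolding planted_eq G_def by (subst cardE) auto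
  qed
  have k: "k > 0" using M by simp
  have "\<eta> * N ^ k \<le> real (card {\<tau> \<in> (streams n k :: 'p day list set). L < real (alg_mistakes A \<tau>)})"
    using card_many_mistakes[OF L(2) k L(1)] by (simp add: card_streams N_def)
  also have "\<dots> = (\<Sum>\<pi>\<in>E. W \<pi>)"
    unfolding streams_eq W_def using days_sub by (subst cardE) (auto simp: Int_absorb1)
  also have "\<dots> = (\<Sum>\<pi>\<in>H. W \<pi>) + (\<Sum>\<pi>\<in>E - H. W \<pi>)"
    using sum.subset_diff[OF HE fE, of W] by simp
  also have "(\<Sum>\<pi>\<in>E - H. W \<pi>) \<le> (\<Sum>\<pi>\<in>E - H. \<eta> / 2 * N ^ k / C)"
    using C0 by (intro sum_mono) (auto simp: H_def field_simps)
  also have "\<dots> \<le> (\<Sum>\<pi>\<in>paths. \<eta> / 2 * N ^ k / C)"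
    using EP fpaths \<eta> N0 C0 by (intro sum_mono2) auto
  also have "\<dots> = \<eta> / 2 * N ^ k"
    using C0 by (simp add: cpaths)
  finally have heavy: "\<eta> / 2 * N ^ k \<le> (\<Sum>\<pi>\<in>H. W \<pi>)" by simp
  have path_bound: "real n / 2 * ((1 - \<delta>) / q) ^ (k - M) * W \<pi> \<le>
      (\<Sum>i<n. \<Sum>B | B \<subseteq> {..<k} \<and> card B = M. G \<pi> i B)" if \<pi>: "\<pi> \<in> H" for \<pi>
  proof -
    have ge: "\<eta> / 2 * N ^ k \<le> C * W \<pi>" using \<pi> by (simp add: H_def)
    moreover have "\<eta> / 2 * N ^ k > 0" using \<eta> N0 by simp
    ultimately have "C * W \<pi> > 0" by linarith
    then have Wpos: "W \<pi> > 0" using C0 by (simp add: zero_less_mult_iff)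
    have ne: "trace_days n A \<pi> t \<noteq> {}" if "t < k" for t
    proof
      assume "trace_days n A \<pi> t = {}"
      then have "W \<pi> = 0" unfolding W_def using that by (intro prod_zero bexI[of _ t]) auto
      then show False using Wpos by simp
    qed
    have "N ^ k / W \<pi> \<le> 2 / \<eta> * C" using ge Wpos \<eta> by (simp add: field_simps)
    then have "ln (N ^ k / W \<pi>) \<le> ln (2 / \<eta> * C)"
      using Wpos N0 by (intro ln_mono) auto
    also have "\<dots> = ln (2 / \<eta>) + ln C" using \<eta> C0 by (intro ln_mult_pos) auto
    also have "ln C = (real s + 1) * real k * ln 2" unfolding C_def by (simp add: ln_realpow algebra_simps)
    finally have "2 * q / \<delta>\<^sup>2 * ln (N ^ k / W \<pi>) \<le> 2 * q / \<delta>\<^sup>2 * (ln (2 / \<eta>) + (real s + 1) * real k * ln 2)"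
      using q \<delta> by (intro mult_left_mono) auto
    then have "2 * q / \<delta>\<^sup>2 * ln (N ^ k / W \<pi>) \<le> real n * real M / 2"
      using space unfolding q_def by linarith
    then show ?thesis
      unfolding q_def N_def W_def G_def
      using planted_class_bound[of k "trace_days n A \<pi>" n \<delta> M, OF days_sub ne \<delta> M] by blast
  qed
  have "real n / 2 * (\<eta> / 2) * (1 - \<delta>) ^ k * (N ^ k * (1 / q) ^ (k - M))
      = real n / 2 * ((1 - \<delta>) ^ k * (1 / q) ^ (k - M)) * (\<eta> / 2 * N ^ k)"
    by (simp add: mult_ac)
  also have "\<dots> \<le> real n / 2 * ((1 - \<delta>) ^ (k - M) * (1 / q) ^ (k - M)) * (\<eta> / 2 * N ^ k)"
    using \<delta> q \<eta> N0 by (intro mult_right_mono mult_left_mono power_decreasing) auto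
  also have "\<dots> = real n / 2 * ((1 - \<delta>) / q) ^ (k - M) * (\<eta> / 2 * N ^ k)"
    by (simp add: power_mult_distrib[symmetric])
  also have "\<dots> \<le> real n / 2 * ((1 - \<delta>) / q) ^ (k - M) * (\<Sum>\<pi>\<in>H. W \<pi>)"
    using heavy \<delta> q by (intro mult_left_mono) auto
  also have "\<dots> \<le> (\<Sum>\<pi>\<in>H. \<Sum>i<n. \<Sum>B | B \<subseteq> {..<k} \<and> card B = M. G \<pi> i B)"
    unfolding sum_distrib_left by (intro sum_mono path_bound)
  also have "\<dots> \<le> (\<Sum>\<pi>\<in>E. \<Sum>i<n. \<Sum>B | B \<subseteq> {..<k} \<and> card B = M. G \<pi> i B)"
    using HE fE by (intro sum_mono2) (auto simp: G_def intro!: sum_nonneg prod_nonneg)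
  also have "\<dots> = (\<Sum>i<n. \<Sum>\<pi>\<in>E. \<Sum>B | B \<subseteq> {..<k} \<and> card B = M. G \<pi> i B)"
    by (rule sum.swap)
  also have "\<dots> = (\<Sum>i<n. \<Sum>B | B \<subseteq> {..<k} \<and> card B = M. \<Sum>\<pi>\<in>E. G \<pi> i B)"
    by (intro sum.cong[OF refl] sum.swap)
  finally show ?thesis by (simp add: cardG q_def N_def)
qed

section \<open>Padding to streams whose best expert makes exactly \<open>M\<close> mistakes\<close>

lemma expert_mistakes_filter: "expert_mistakes \<sigma> i = length (filter (\<lambda>d. fst d ! i \<noteq> snd d) \<sigma>)"
  by (simp add: expert_mistakes_def length_filter_conv_card)

text \<open>Days on which all experts agree shift all mistake counts equally, so the best expert can be
  brought to exactly \<open>M\<close> mistakes.\<close>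

lemma extend_stream:
  fixes \<tau> :: "'p::finite day list"
  assumes "\<tau> \<in> streams n k" "i < n" "expert_mistakes \<tau> i \<le> M" "k + M \<le> T" "CARD('p) \<ge> 2"
  obtains \<sigma> where "\<sigma> \<in> streams n T" "best_expert_mistakes n \<sigma> = M"
    "\<And>A. alg_mistakes A \<tau> \<le> alg_mistakes A \<sigma>"
proof -
  obtain u v :: 'p where uv: "u \<noteq> v"
    using assms(5) card_le_Suc0_iff_eq[of "UNIV :: 'p set"] by fastforce
  define m where "m = best_expert_mistakes n \<tau>"
  \<comment> \<open>First all experts err on \<open>M - m\<close> days, then all are right until day
    \<open>T\<close>; \<open>k + M \<le> T\<close> ensures that this fits.\<close>
  define \<sigma> where "\<sigma> = \<tau> @ replicate (M - m) (replicate n u, v) @ replicate (T - k - (M - m)) (replicate n u, u)"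
  have m: "m \<le> M"
    unfolding m_def best_expert_mistakes_def using assms(2,3) by (intro Min.coboundedI[THEN order_trans]) auto
  have "expert_mistakes \<sigma> j = expert_mistakes \<tau> j + (M - m)" if "j < n" for j
    using that uv by (simp add: \<sigma>_def expert_mistakes_filter filter_replicate)
  then have "expert_mistakes \<sigma> ` {..<n} = (\<lambda>j. expert_mistakes \<tau> j + (M - m)) ` {..<n}"
    by (intro image_cong) auto
  then have "best_expert_mistakes n \<sigma> = Min ((\<lambda>j. expert_mistakes \<tau> j + (M - m)) ` {..<n})"
    by (simp add: best_expert_mistakes_def)
  also have "\<dots> = m + (M - m)"
    unfolding m_def best_expert_mistakes_def using assms(2) by (intro Min_add_commute) auto
  finally have best: "best_expert_mistakes n \<sigma> = M" using m by simp
  have "\<sigma> \<in> streams n T" using assms(1,4) by (auto simp: streams_def \<sigma>_def)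
  moreover have "alg_mistakes A \<tau> \<le> alg_mistakes A \<sigma>" for A
    unfolding alg_mistakes_def \<sigma>_def by (rule mistakes_from_append_ge)
  ultimately show thesis using best that by blast
qed

text \<open>The regret guarantee speaks only about streams of length \<open>T\<close> whose best
  expert makes exactly \<open>M\<close> mistakes. It transfers to the shorter \<open>\<tau>\<close>
  because mistakes made on a prefix remain in the total.\<close>

lemma prob_many_mistakes_le:
  fixes \<tau> :: "'p::finite day list" and \<A> :: "'p rand_alg"
  assumes "achieves_regret n T M R (1 - \<epsilon>) \<A>"
    and "\<tau> \<in> streams n k" "i < n" "expert_mistakes \<tau> i \<le> M" "k + M \<le> T" "CARD('p) \<ge> 2"
  shows "measure_pmf.prob \<A> {A. real M + R * real T < real (alg_mistakes A \<tau>)} \<le> \<epsilon>"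
proof -
  obtain \<sigma> where \<sigma>: "\<sigma> \<in> streams n T" "best_expert_mistakes n \<sigma> = M"
    "\<And>A. alg_mistakes A \<tau> \<le> alg_mistakes A \<sigma>"
    using extend_stream[OF assms(2-6)] by blast
  let ?Q = "{A. real (alg_mistakes A \<sigma>) \<le> real M + R * real T}"
  have "measure_pmf.prob \<A> {A. real M + R * real T < real (alg_mistakes A \<tau>)} \<le> measure_pmf.prob \<A> (UNIV - ?Q)"
  proof (intro measure_pmf.finite_measure_mono subsetI)
    fix A assume "A \<in> {A. real M + R * real T < real (alg_mistakes A \<tau>)}"
    moreover have "real (alg_mistakes A \<tau>) \<le> real (alg_mistakes A \<sigma>)" using \<sigma>(3) by simp
    ultimately show "A \<in> UNIV - ?Q" by simp
  qed simp
  also have "\<dots> = 1 - measure_pmf.prob \<A> ?Q"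
    using measure_pmf.prob_compl[of ?Q \<A>] by simp
  also have "\<dots> \<le> \<epsilon>"
    using assms(1) \<sigma>(1,2) unfolding achieves_regret_def by fastforce
  finally show ?thesis .
qed

section \<open>Averaging over the random choices\<close>

text \<open>The easy direction of Yao's principle: the expected number of failing inputs
  \<open>z\<close> is computed in both orders of summation.\<close>

lemma pmf_count_le:
  assumes "finite Z" "\<And>x. x \<in> set_pmf p \<Longrightarrow> K \<le> real (card {z \<in> Z. P x z})"
    and "\<And>z. z \<in> Z \<Longrightarrow> measure_pmf.prob p {x. P x z} \<le> \<epsilon>"
  shows "K \<le> \<epsilon> * real (card Z)"
proof -
  have count: "real (card {z \<in> Z. P x z}) = (\<Sum>z\<in>Z. indicator {x. P x z} x)" for x
    using assms(1) by (simp add: indicator_def sum.If_cases Collect_conj_eq)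
  have int: "integrable (measure_pmf p) (indicator {x. P x z} :: _ \<Rightarrow> real)" for z
    by (rule measure_pmf.integrable_const_bound[where B = 1]) (auto simp: indicator_def)
  have "K \<le> measure_pmf.expectation p (\<lambda>x. \<Sum>z\<in>Z. indicator {x. P x z} x)"
  proof (rule measure_pmf.integral_ge_const)
    show "integrable (measure_pmf p) (\<lambda>x. \<Sum>z\<in>Z. indicator {x. P x z} x :: real)"
      by (intro Bochner_Integration.integrable_sum int)
    show "AE x in measure_pmf p. K \<le> (\<Sum>z\<in>Z. indicator {x. P x z} x)"
      using assms(2) by (simp add: AE_measure_pmf_iff count[symmetric])
  qed
  also have "\<dots> = (\<Sum>z\<in>Z. measure_pmf.prob p {x. P x z})"
    using int by (subst Bochner_Integration.integral_sum) auto
  also have "\<dots> \<le> (\<Sum>z\<in>Z. \<epsilon>)" by (intro sum_mono assms(3))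
  finally show ?thesis by (simp add: mult.commute)
qed

text \<open>Needed because the bound on traces only gives a bound on \<open>s + 1\<close>, which is void for small
  \<open>n\<close>. Expert predictions that are the same on every day reveal nothing about a constant
  outcome.\<close>

lemma no_memory_bound:
  fixes \<A> :: "'p::finite rand_alg"
  assumes "uses_space 0 \<A>" "achieves_regret n T M R (1 - \<epsilon>) \<A>"
    and "CARD('p) \<le> n" "k + M \<le> T" "CARD('p) \<ge> 2"
    and L: "real M + R * real T < (1 - 1 / real CARD('p)) * real k"
  shows "1 \<le> \<epsilon> * real CARD('p)"
proof -
  obtain ys where ys: "set ys = (UNIV :: 'p set)" "distinct ys"
    using finite_distinct_list[of "UNIV :: 'p set"] by auto
  \<comment> \<open>Every possible prediction occurs in \<open>xs\<close>, so for each constant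
    outcome some expert is always right; the padding value is arbitrary.\<close>
  define xs where "xs = ys @ replicate (n - length ys) (SOME y. True)"
  have lys: "length ys = CARD('p)" using ys distinct_card by fastforce
  then have lxs: "length xs = n" using assms(3) by (simp add: xs_def)
  define \<tau> where "\<tau> y = replicate k (xs, y)" for y :: 'p
  have "\<exists>y. real M + R * real T < real (alg_mistakes A (\<tau> y))" if A: "A \<in> set_pmf \<A>" for A
  proof (rule ccontr)
    assume "\<not> ?thesis"
    then have le: "real (alg_mistakes A (\<tau> y)) \<le> real M + R * real T" for y by (simp add: not_less)
    have det: "init A = []" "update A t [] x y = []" for t x y
      using A assms(1) by (auto simp: uses_space_def det_space_def)
    \<comment> \<open>Without memory, the prediction on a day is the same for all the streams
      \<open>\<tau> y\<close>, so on every day it is wrong for all outcomes \<open>y\<close> but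
      one.\<close>
    have "(\<Sum>y\<in>UNIV. real (mistakes_from A t [] (replicate j (xs, y)))) = real j * (real CARD('p) - 1)" for t j
    proof (induction j arbitrary: t)
      case (Suc j)
      have "(\<Sum>y\<in>UNIV. real (mistakes_from A t [] (replicate (Suc j) (xs, y)))) =
          (\<Sum>y\<in>UNIV. 1 - (if predict A t [] xs = y then 1 else 0)
            + real (mistakes_from A (Suc t) [] (replicate j (xs, y))))"
        by (rule sum.cong) (auto simp: det)
      also have "\<dots> = real (Suc j) * (real CARD('p) - 1)"
        by (simp add: sum.distrib sum_subtractf Suc algebra_simps)
      finally show ?case .
    qed simp
    then have "real k * (real CARD('p) - 1) = (\<Sum>y\<in>UNIV. real (alg_mistakes A (\<tau> y)))"
      by (simp add: alg_mistakes_def det \<tau>_def)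
    also have "\<dots> \<le> (\<Sum>y\<in>(UNIV::'p set). real M + R * real T)" by (intro sum_mono le)
    also have "\<dots> = real CARD('p) * (real M + R * real T)" by simp
    also have "\<dots> < real CARD('p) * ((1 - 1 / real CARD('p)) * real k)"
      using L by (intro mult_strict_left_mono) auto
    also have "\<dots> = real k * (real CARD('p) - 1)" by (simp add: field_simps)
    finally show False by simp
  qed
  then have "1 \<le> real (card {y \<in> UNIV. real M + R * real T < real (alg_mistakes A (\<tau> y))})"
    if "A \<in> set_pmf \<A>" for A
    using that by (force simp: card_gt_0_iff Suc_le_eq)
  moreover have "measure_pmf.prob \<A> {A. real M + R * real T < real (alg_mistakes A (\<tau> y))} \<le> \<epsilon>" for y
  proof -
    obtain i where i: "i < length ys" "ys ! i = y" using ys(1) by (metis UNIV_I in_set_conv_nth)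
    show ?thesis
    proof (rule prob_many_mistakes_le[OF assms(2)])
      show "\<tau> y \<in> streams n k" by (simp add: \<tau>_def streams_def lxs)
      show "i < n" using i lys assms(3) by simp
      show "expert_mistakes (\<tau> y) i \<le> M"
        using i by (simp add: expert_mistakes_filter \<tau>_def xs_def nth_append filter_replicate)
    qed (use assms in auto)
  qed
  ultimately show ?thesis
    using pmf_count_le[of "UNIV :: 'p set" \<A> 1 "\<lambda>A y. real M + R * real T < real (alg_mistakes A (\<tau> y))" \<epsilon>]
    by auto
qed

lemma expert_mistakes_planted:
  assumes "\<tau> \<in> planted n k i B" "card B = M" "finite B"
  shows "expert_mistakes \<tau> i \<le> M"
proof -
  have "{t. t < length \<tau> \<and> fst (\<tau> ! t) ! i \<noteq> snd (\<tau> ! t)} \<subseteq> B"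
    using assms(1) by (auto simp: planted_def streams_def)
  then show ?thesis unfolding expert_mistakes_def using assms by (metis card_mono)
qed

text \<open>The hard distribution is uniform on triples of an expert, a set of \<open>M\<close> free
  days and a stream planted accordingly. All planted sets have the same size, so \<open>n\<close>
  and this size cancel, and the choice of the free days leaves the factor
  \<open>k choose M\<close>.\<close>

lemma failure_probability_bound:
  fixes \<A> :: "'p::finite rand_alg"
  assumes "uses_space s \<A>" "achieves_regret n T M R (1 - \<epsilon>) \<A>"
    and "n > 0" "k + M \<le> T" "CARD('p) \<ge> 2"
    and \<delta>: "0 < \<delta>" "\<delta> < 1" and M: "1 \<le> M" "M \<le> k" and \<eta>: "0 < \<eta>" and R: "0 \<le> R"
    and L: "real M + R * real T \<le> (1 - 1 / real CARD('p) - \<eta>) * real k"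
    and space: "2 * real CARD('p) / \<delta>\<^sup>2 * (ln (2 / \<eta>) + (real s + 1) * real k * ln 2) \<le> real n * real M / 2"
  shows "\<eta> / 4 * (1 - \<delta>) ^ k \<le> \<epsilon> * real (k choose M)"
proof -
  define W where "W = real (card (days n :: 'p day set)) ^ k * (1 / real CARD('p)) ^ (k - M)"
  define Bs where "Bs = {B. B \<subseteq> {..<k} \<and> card B = M}"
  \<comment> \<open>Triples instead of streams, so that a stream planted in several ways is counted
    as often as in \<open>planted_many_mistakes\<close>.\<close>
  define Z where "Z = (SIGMA i:{..<n}. SIGMA B:Bs. (planted n k i B :: 'p day list set))"
  define fails where "fails A z = (real M + R * real T < real (alg_mistakes A (snd (snd z))))"
    for A :: "'p streaming_alg" and z :: "nat \<times> nat set \<times> 'p day list"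
  have W0: "W > 0" unfolding W_def using card_days_pos[where 'p='p] by simp
  have fBs: "finite Bs" by (simp add: Bs_def)
  have cBs: "card Bs = k choose M" unfolding Bs_def using n_subsets[of "{..<k}" M] by simp
  have fpl: "finite (planted n k i B :: 'p day list set)" for i B
    by (rule finite_subset[of _ "streams n k"]) (auto simp: planted_def)
  have fZ: "finite Z" using fBs fpl by (auto simp: Z_def)
  have "real (card Z) = (\<Sum>i<n. \<Sum>B\<in>Bs. real (card (planted n k i B :: 'p day list set)))"
    unfolding Z_def using fBs fpl by (subst card_SigmaI) (auto simp: card_SigmaI)
  also have "\<dots> = (\<Sum>i<n. \<Sum>B\<in>Bs. W)"
    unfolding W_def by (intro sum.cong[OF refl] card_planted) (auto simp: Bs_def)
  finally have cZ: "real (card Z) = real n * real (k choose M) * W" by (simp add: cBs)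
  have "real n / 2 * (\<eta> / 2) * (1 - \<delta>) ^ k * W \<le> \<epsilon> * real (card Z)"
  proof (rule pmf_count_le[OF fZ])
    fix A assume "A \<in> set_pmf \<A>"
    then have A: "det_space s A" using assms(1) by (simp add: uses_space_def)
    have fails_eq: "{z \<in> Z. fails A z} = (SIGMA i:{..<n}. SIGMA B:Bs.
        {\<tau> \<in> planted n k i B. real M + R * real T < real (alg_mistakes A \<tau>)})"
      by (auto simp: Z_def fails_def)
    have "real (card {z \<in> Z. fails A z}) = (\<Sum>i<n. \<Sum>B\<in>Bs.
        real (card {\<tau> \<in> planted n k i B. real M + R * real T < real (alg_mistakes A \<tau>)}))"
      unfolding fails_eq using fBs fpl by (subst card_SigmaI) (auto simp: card_SigmaI)
    moreover have "0 \<le> real M + R * real T" using R by simp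
    ultimately show "real n / 2 * (\<eta> / 2) * (1 - \<delta>) ^ k * W \<le> real (card {z \<in> Z. fails A z})"
      unfolding W_def Bs_def using planted_many_mistakes[OF A \<delta> M \<eta> _ L space] by simp
  next
    fix z assume z: "z \<in> Z"
    then obtain i B \<tau> where z_eq: "z = (i, B, \<tau>)" and "i < n" "B \<in> Bs" "\<tau> \<in> planted n k i B"
      by (auto simp: Z_def)
    then have "expert_mistakes \<tau> i \<le> M" "\<tau> \<in> streams n k"
      by (auto intro!: expert_mistakes_planted simp: Bs_def planted_def intro: finite_subset)
    then show "measure_pmf.prob \<A> {A. fails A z} \<le> \<epsilon>"
      using prob_many_mistakes_le[OF assms(2) _ \<open>i < n\<close>] assms(4,5) by (simp add: fails_def z_eq)
  qed
  then have "(real n * W) * (\<eta> / 4 * (1 - \<delta>) ^ k) \<le> (real n * W) * (\<epsilon> * real (k choose M))"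
    by (simp add: cZ mult_ac)
  moreover have "real n * W > 0" using W0 assms(3) by simp
  ultimately show ?thesis by (rule mult_left_le_imp_le)
qed

section \<open>Choice of the parameters for large \<open>T\<close>\<close>

text \<open>The number \<open>k\<close> of hard days is a fraction \<open>\<kappa>\<close> of \<open>T\<close>: proportional to \<open>R\<close>, as the bound
  requires, yet large enough for random outcomes to cause more than \<open>M + R T\<close> mistakes.\<close>

lemma eventually_hard_days:
  fixes a q R :: real
  assumes "a > 0" "q \<ge> 2" "0 < R" "R < 1 - 1 / q"
  obtains \<eta> where "\<eta> > 0"
    "\<forall>\<^sub>F T in sequentially. \<exists>k. k > 0 \<and> real k \<le> 4 * R * real T \<and> k + M \<le> T \<and> M \<le> k \<and>
      real M + R * real T \<le> (1 - 1 / q - \<eta>) * real k \<and> ln (2 / \<eta>) \<le> real k \<and>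
      2 powr (- a * real T) * real (k choose M) < \<eta> / 4 * (2 powr (- a / 2)) ^ k \<and>
      2 powr (- a * real T) * q < 1"
proof -
  define p where "p = 1 - 1 / q"
  define r where "r = R / p"
  \<comment> \<open>On \<open>r * T\<close> random days about \<open>R * T\<close> mistakes are
    expected, so \<open>\<kappa>\<close> must exceed \<open>r\<close>. As
    \<open>\<kappa> = 1 - (1 - r)\<^sup>2\<close>, it lies strictly between \<open>r\<close> and
    \<open>1\<close>, and it is at most \<open>2 * r\<close>.\<close>
  define \<kappa> where "\<kappa> = r * (2 - r)"
  \<comment> \<open>Half of the slack: \<open>p - \<eta>\<close> is the midpoint of \<open>p\<close>
    and \<open>R / \<kappa>\<close>, so \<open>(p - \<eta>) * \<kappa>\<close> still exceeds
    \<open>R\<close>.\<close>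
  define \<eta> where "\<eta> = (p - R / \<kappa>) / 2"
  have p: "1 / 2 \<le> p" "p < 1" using assms(2) by (auto simp: p_def field_simps)
  have r: "0 < r" "r < 1" "r \<le> 2 * R" using assms p by (auto simp: r_def p_def field_simps)
  have \<kappa>: "0 < \<kappa>" using r by (simp add: \<kappa>_def)
  have \<kappa>1: "\<kappa> < 1"
  proof -
    have "(1 - r)\<^sup>2 > 0" using r by simp
    then show ?thesis by (simp add: \<kappa>_def power2_eq_square algebra_simps)
  qed
  have r\<kappa>: "r < \<kappa>" using r by (simp add: \<kappa>_def)
  have "\<kappa> \<le> 2 * r" using r by (simp add: \<kappa>_def)
  then have \<kappa>R: "\<kappa> \<le> 4 * R" using r by simp
  have "R = p * r" using p by (simp add: r_def)
  then have "R < p * \<kappa>" using r\<kappa> p by simp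
  then have \<eta>: "\<eta> > 0" using \<kappa> by (simp add: \<eta>_def field_simps)
  define x where "x = p - \<eta>"
  have x: "x * \<kappa> > R" "x > 0"
  proof -
    have x_eq: "x = (p + R / \<kappa>) / 2" by (simp add: x_def \<eta>_def field_simps)
    then have "x * \<kappa> = (p * \<kappa> + R) / 2" using \<kappa> by (simp add: field_simps)
    then show "x * \<kappa> > R" using \<open>R < p * \<kappa>\<close> by simp
    have "R / \<kappa> > 0" using assms(3) \<kappa> by simp
    then have "p + R / \<kappa> > 0" using p by (intro add_pos_pos) auto
    then show "x > 0" unfolding x_eq by simp
  qed
  have "\<forall>\<^sub>F T in sequentially. \<kappa> * real T + real M \<le> real T"
    using \<kappa>1 by real_asymp
  moreover have "\<forall>\<^sub>F T in sequentially. real M + R * real T \<le> x * (\<kappa> * real T - 1)"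
  proof -
    have "filterlim (\<lambda>T. (x * \<kappa> - R) * real T - (real M + x)) at_top sequentially"
      using x(1) by real_asymp
    then have "\<forall>\<^sub>F T in sequentially. 0 \<le> (x * \<kappa> - R) * real T - (real M + x)"
      by (rule eventually_compose_filterlim[OF eventually_ge_at_top])
    then show ?thesis by (rule eventually_mono) (simp add: algebra_simps)
  qed
  moreover have "\<forall>\<^sub>F T in sequentially. max 1 (max (real M) (ln (2 / \<eta>))) \<le> \<kappa> * real T - 1"
    using \<kappa> by real_asymp
  moreover have "\<forall>\<^sub>F T in sequentially. real T ^ M * 2 powr (- a / 2 * real T) < \<eta> / 4"
  proof -
    have "(\<lambda>T. real T ^ M * 2 powr (- a / 2 * real T)) \<longlonglongrightarrow> 0"
      using assms(1) by real_asymp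
    then show ?thesis using \<eta> by (intro order_tendstoD(2)[where y = 0]) auto
  qed
  moreover have "\<forall>\<^sub>F T in sequentially. 2 powr (- a * real T) * q < 1"
    using assms(1,2) by real_asymp
  ultimately have "\<forall>\<^sub>F T in sequentially. \<exists>k. k > 0 \<and> real k \<le> 4 * R * real T \<and> k + M \<le> T \<and> M \<le> k \<and>
      real M + R * real T \<le> (1 - 1 / q - \<eta>) * real k \<and> ln (2 / \<eta>) \<le> real k \<and>
      2 powr (- a * real T) * real (k choose M) < \<eta> / 4 * (2 powr (- a / 2)) ^ k \<and>
      2 powr (- a * real T) * q < 1"
  proof eventually_elim
    case (elim T)
    define k where "k = nat \<lfloor>\<kappa> * real T\<rfloor>"
    have k: "\<kappa> * real T - 1 < real k" "real k \<le> \<kappa> * real T"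
      using \<kappa> by (auto simp: k_def)
    have kT: "k + M \<le> T" using k elim(1) by linarith
    have "real (k choose M) \<le> real T ^ M"
    proof (cases "M \<le> k")
      case True
      then have "k choose M \<le> k ^ M" by (rule binomial_le_pow)
      also have "\<dots> \<le> T ^ M" using kT by (intro power_mono) auto
      finally show ?thesis by (metis of_nat_le_iff of_nat_power)
    qed (simp add: binomial_eq_0)
    then have "2 powr (- a * real T) * real (k choose M) \<le> 2 powr (- a * real T) * real T ^ M"
      by (intro mult_left_mono) auto
    \<comment> \<open>One half of the exponent absorbs the polynomial \<open>T ^ M\<close>; the
      other half is compared with \<open>k \<le> T\<close> days.\<close>
    also have "\<dots> = 2 powr (- a / 2 * real T) * (real T ^ M * 2 powr (- a / 2 * real T))"
      by (simp add: powr_add[symmetric])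
    also have "\<dots> < 2 powr (- a / 2 * real T) * (\<eta> / 4)"
      using elim(4) by (intro mult_strict_left_mono) auto
    also have "\<dots> \<le> 2 powr (- a / 2 * real k) * (\<eta> / 4)"
      using kT assms(1) \<eta> by (intro mult_right_mono) auto
    also have "\<dots> = \<eta> / 4 * (2 powr (- a / 2)) ^ k"
      by (simp add: powr_power mult.commute)
    finally have prob: "2 powr (- a * real T) * real (k choose M) < \<eta> / 4 * (2 powr (- a / 2)) ^ k" .
    have "x * (\<kappa> * real T - 1) \<le> x * real k" using k x by (intro mult_left_mono) auto
    then have mist: "real M + R * real T \<le> (1 - 1 / q - \<eta>) * real k" using elim(2) by (simp add: x_def p_def)
    have "\<kappa> * real T \<le> 4 * R * real T" using \<kappa>R by (intro mult_right_mono) auto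
    then have "real k \<le> 4 * R * real T" using k by linarith
    moreover have "k > 0" "M \<le> k" "ln (2 / \<eta>) \<le> real k" using elim(3) k by linarith+
    ultimately show ?case using kT prob mist elim(5) by blast
  qed
  with \<eta> show thesis by (rule that)
qed

section \<open>The space lower bound\<close>

text \<open>The constant \<open>c\<close> is chosen before \<open>R\<close>, \<open>M\<close> and
  \<open>n\<close>, so it depends only on \<open>a\<close> and the number of predictions; only the
  threshold for \<open>T\<close> depends on the rest.\<close>

theorem theorem3p8:
  fixes a :: real
  assumes "a > 0" and "CARD('p::finite) \<ge> 2"
  shows "\<exists>c>0. \<forall>(R::real) (M::nat) (n::nat \<Rightarrow> nat).
    0 < R \<and> R < 1 - 1 / real CARD('p) \<and>
    (\<forall>\<^sub>F T in sequentially. CARD('p) \<le> n T) \<and>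
    (\<lambda>T. real (n T)) \<in> o(\<lambda>T. 2 ^ T) \<longrightarrow>
    (\<forall>\<^sub>F T in sequentially. \<forall>(s::nat) (\<A>::'p rand_alg).
       uses_space s \<A> \<and>
       achieves_regret (n T) T M R (1 - 2 powr (- a * real T)) \<A> \<longrightarrow>
       real s \<ge> c * (real (n T) * real M / (R * real T)))"
proof -
  define q where "q = real CARD('p)"
  \<comment> \<open>Makes \<open>(1 - \<delta>) ^ k\<close> equal to
    \<open>(2 powr (- a / 2)) ^ k\<close>, which the allowed failure probability cannot reach even
    after multiplication by \<open>k choose M\<close>.\<close>
  define \<delta> :: real where "\<delta> = 1 - 2 powr (- a / 2)"
  \<comment> \<open>Solves \<open>2 * q / \<delta>\<^sup>2 * 12 * c = 1 / 2\<close>. The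
    \<open>12\<close> combines \<open>s + 2 \<le> 3 * s\<close>, valid for
    \<open>s \<noteq> 0\<close>, with \<open>k \<le> 4 * R * T\<close>.\<close>
  define c where "c = \<delta>\<^sup>2 / (48 * q)"
  have q: "q \<ge> 2" using assms(2) by (simp add: q_def)
  have \<delta>: "0 < \<delta>" "\<delta> < 1" using assms(1) by (auto simp: \<delta>_def powr_less_one)
  have c: "c > 0" using \<delta> q by (simp add: c_def)
  show ?thesis
  proof (intro exI[of _ c] conjI c allI impI, elim conjE)
    fix R :: real and M :: nat and n :: "nat \<Rightarrow> nat"
    assume R: "0 < R" "R < 1 - 1 / real CARD('p)" and n: "\<forall>\<^sub>F T in sequentially. CARD('p) \<le> n T"
    obtain \<eta> where \<eta>: "\<eta> > 0" and ev: "\<forall>\<^sub>F T in sequentially. \<exists>k. k > 0 \<and> real k \<le> 4 * R * real T \<and>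
      k + M \<le> T \<and> M \<le> k \<and> real M + R * real T \<le> (1 - 1 / q - \<eta>) * real k \<and> ln (2 / \<eta>) \<le> real k \<and>
      2 powr (- a * real T) * real (k choose M) < \<eta> / 4 * (2 powr (- a / 2)) ^ k \<and>
      2 powr (- a * real T) * q < 1"
      using eventually_hard_days[OF assms(1) q R[folded q_def], of M] by blast
    show "\<forall>\<^sub>F T in sequentially. \<forall>(s::nat) (\<A>::'p rand_alg).
       uses_space s \<A> \<and> achieves_regret (n T) T M R (1 - 2 powr (- a * real T)) \<A> \<longrightarrow>
       real s \<ge> c * (real (n T) * real M / (R * real T))"
      using n ev
    proof eventually_elim
      case (elim T)
      from elim(2) obtain k where k: "k > 0" "real k \<le> 4 * R * real T" "k + M \<le> T" "M \<le> k"
        and L: "real M + R * real T \<le> (1 - 1 / q - \<eta>) * real k" and k_ln: "ln (2 / \<eta>) \<le> real k"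
        and prob: "2 powr (- a * real T) * real (k choose M) < \<eta> / 4 * (2 powr (- a / 2)) ^ k"
          "2 powr (- a * real T) * q < 1"
        by blast
      have T: "T > 0" using k by simp
      show ?case
      proof (intro allI impI, elim conjE, rule ccontr)
        fix s :: nat and \<A> :: "'p rand_alg"
        assume \<A>: "uses_space s \<A>" "achieves_regret (n T) T M R (1 - 2 powr (- a * real T)) \<A>"
          and "\<not> real s \<ge> c * (real (n T) * real M / (R * real T))"
        then have "real s < c * (real (n T) * real M / (R * real T))" by simp
        then have small: "real s * (R * real T) < c * (real (n T) * real M)"
          using R T by (simp add: field_simps)
        \<comment> \<open>For \<open>M = 0\<close> the right-hand side of \<open>small\<close>
          vanishes while the left-hand side is nonnegative.\<close>
        then have M: "1 \<le> M" using R T by (cases M) (auto simp: mult_less_0_iff)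
        have s: "s \<noteq> 0"
        proof
          assume "s = 0"
          have "(1 - 1 / q - \<eta>) * real k < (1 - 1 / q) * real k" using \<eta> k(1) by simp
          then have "real M + R * real T < (1 - 1 / real CARD('p)) * real k"
            using L by (simp add: q_def)
          from no_memory_bound[OF \<A>[unfolded \<open>s = 0\<close>] elim(1) k(3) assms(2) this]
          show False using prob(2) by (simp add: q_def)
        qed
        have "(real s + 1) * real k * ln 2 \<le> (real s + 1) * real k * 1"
          using ln_2_less_1 by (intro mult_left_mono) auto
        then have "ln (2 / \<eta>) + (real s + 1) * real k * ln 2 \<le> (real s + 2) * real k"
          using k_ln by (simp add: algebra_simps)
        also have "\<dots> \<le> (3 * real s) * (4 * R * real T)"
          using k(2) s by (intro mult_mono) auto
        also have "\<dots> = 12 * (real s * (R * real T))" by simp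
        also have "\<dots> \<le> 12 * (c * (real (n T) * real M))" using small by simp
        finally have "2 * q / \<delta>\<^sup>2 * (ln (2 / \<eta>) + (real s + 1) * real k * ln 2)
            \<le> 2 * q / \<delta>\<^sup>2 * (12 * (c * (real (n T) * real M)))"
          using q by (intro mult_left_mono) auto
        also have "\<dots> = real (n T) * real M / 2"
          using q \<delta> by (simp add: c_def field_simps)
        finally have space: "2 * q / \<delta>\<^sup>2 * (ln (2 / \<eta>) + (real s + 1) * real k * ln 2)
            \<le> real (n T) * real M / 2" .
        have "n T > 0" using elim(1) zero_less_card_finite[where 'a='p] by linarith
        then have "\<eta> / 4 * (1 - \<delta>) ^ k \<le> 2 powr (- a * real T) * real (k choose M)"
          using R(1) by (intro failure_probability_bound[OF \<A> _ k(3) assms(2) \<delta> M k(4) \<eta> _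
              L[unfolded q_def] space[unfolded q_def]]) auto
        then show False using prob(1) by (simp add: \<delta>_def)
      qed
    qed
  qed
qed

end
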